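(* Let $G_1^{u_1}$ and $G_2^{u_2}$ be two rooted graphs, where $G_1$ and $G_2$ are nontrivial connected graphs. If $G_1$ is not a path with an end-vertex $u_1$ (i.e. it is not the case that $G_1$ is a path having $u_1$ as one of its end-vertices), then $$\dim_f(G_2^{u_2}\sqcap G_1^{u_1})=|V(G_2)|\cdot\mathrm{rdim}_f(G_1^{u_1}).$$
   Context: All graphs are finite, simple, nontrivial (at least two vertices) and connected. For a graph $G$, $V(G)$ and $E(G)$ are its vertex and edge sets, $d_G(u,v)$ is the distance between $u$ and $v$, and $R_G\{u,v\}=\{w\in V(G) : d_G(u,w)\neq d_G(v,w)\}$. For a function $g:V(G)\to[0,1]$ and $W\subseteq V(G)$ write $g(W)=\sum_{v\in W}g(v)$; the weight of $g$ is $|g|=g(V(G))$. The function $g$ is a resolving function of $G$ if $g(R_G\{u,v\})\geq 1$ for any two distinct vertices $u,v$. The fractional metric dimension $\dim_f(G)$ is the minimum weight of a resolving function of $G$. A rooted graph $G^u$ is a graph $G$ with a distinguished vertex $u$, its root. Put $\mathcal{P}^u=\{\{v,w\} : v,w\in V(G), v\neq w, d_G(v,u)=d_G(w,u)\}$. If $G^u$ is not a path with an end-vertex $u$, a rooted resolving function of $G^u$ is a function $g:V(G)\to[0,1]$ such that $g(R_G\{v,w\})\geq 1$ for each $\{v,w\}\in\mathcal{P}^u$, and the fractional rooted metric dimension $\mathrm{rdim}_f(G^u)$ is the minimum weight of a rooted resolving function of $G^u$. The hierarchical product $G_2^{u_2}\sqcap G_1^{u_1}$ of rooted graphs is the rooted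 graph with vertex set $\{x_2x_1 : x_i\in V(G_i), i=1,2\}$ (pairs), root $u_2u_1$, in which $x_2x_1$ is adjacent to $y_2y_1$ whenever $x_2=y_2$ and $\{x_1,y_1\}\in E(G_1)$, or $x_1=y_1=u_1$ and $\{x_2,y_2\}\in E(G_2)$. The fractional metric dimension of a rooted graph is that of the underlying graph. *)

theory Defs
  imports "Graph_Theory.Graph_Theory" "HOL-Analysis.Analysis"
begin

(* A finite simple graph is a pair_graph: a finite loopfree symmetric digraph, where the undirected
   edge {x, y} is represented by the two arcs (x, y) and (y, x).  The constant connected of
   Graph_Theory is always written with its qualifier, because Topological_Spaces has one of the
   same name. *)
definition nontrivial_connected_graph :: "'a pair_pre_digraph \<Rightarrow> bool" where
  "nontrivial_connected_graph G \<longleftrightarrow>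
     pair_graph G \<and> Digraph_Component.connected (with_proj G) \<and> card (pverts G) \<ge> 2"

(* The distance is the minimum cost of a walk for the unit weight function; it is extended-real
   valued only because Graph_Theory's shortest path cost is. *)
definition gdist :: "'a pair_pre_digraph \<Rightarrow> 'a \<Rightarrow> 'a \<Rightarrow> ereal" where
  "gdist G u v = wf_digraph.\<mu> (with_proj G) (\<lambda>_. 1) u v"

definition resolving_set :: "'a pair_pre_digraph \<Rightarrow> 'a \<Rightarrow> 'a \<Rightarrow> 'a set" where
  "resolving_set G u v = {w \<in> pverts G. gdist G u w \<noteq> gdist G v w}"

(* Functions V(G) -> [0,1] are total functions whose values outside of V(G) are irrelevant. *)
definition resolving_function :: "'a pair_pre_digraph \<Rightarrow> ('a \<Rightarrow> real) \<Rightarrow> bool" where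
  "resolving_function G g \<longleftrightarrow>
     g \<in> pverts G \<rightarrow> {0..1} \<and>
     (\<forall>u\<in>pverts G. \<forall>v\<in>pverts G. u \<noteq> v \<longrightarrow> sum g (resolving_set G u v) \<ge> 1)"

(* The least element of the set of weights; it exists by resolving_function_attains_min below. *)
definition frac_metric_dim :: "'a pair_pre_digraph \<Rightarrow> real" where
  "frac_metric_dim G = (LEAST w. \<exists>g. resolving_function G g \<and> w = sum g (pverts G))"

type_synonym 'a rooted_graph = "'a pair_pre_digraph \<times> 'a"

definition path_with_end_root :: "'a rooted_graph \<Rightarrow> bool" where
  "path_with_end_root = (\<lambda>(G, u).
     \<exists>xs. xs \<noteq> [] \<and> distinct xs \<and> pverts G = set xs \<and>
       parcs G = {(xs ! i, xs ! Suc i) | i. Suc i < length xs} \<union>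
                 {(xs ! Suc i, xs ! i) | i. Suc i < length xs} \<and>
       (u = hd xs \<or> u = last xs))"

definition rooted_resolving_function :: "'a rooted_graph \<Rightarrow> ('a \<Rightarrow> real) \<Rightarrow> bool" where
  "rooted_resolving_function = (\<lambda>(G, u) g.
     g \<in> pverts G \<rightarrow> {0..1} \<and>
     (\<forall>v\<in>pverts G. \<forall>w\<in>pverts G.
        v \<noteq> w \<and> gdist G v u = gdist G w u \<longrightarrow> sum g (resolving_set G v w) \<ge> 1))"

(* The least weight exists by rooted_resolving_function_attains_min below.  Only
   meaningful if the rooted graph is not a path with the root as an end-vertex. *)
definition frac_rooted_metric_dim :: "'a rooted_graph \<Rightarrow> real" where
  "frac_rooted_metric_dim R =
     (LEAST w. \<exists>g. rooted_resolving_function R g \<and> w = sum g (pverts (fst R)))"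

definition hierarchical_product ::
  "'b rooted_graph \<Rightarrow> 'a rooted_graph \<Rightarrow> ('b \<times> 'a) rooted_graph" where
  "hierarchical_product = (\<lambda>(G2, u2) (G1, u1).
     (\<lparr> pverts = pverts G2 \<times> pverts G1,
        parcs = {((x2, x1), (y2, y1)) | x2 x1 y2 y1.
                   (x2, x1) \<in> pverts G2 \<times> pverts G1 \<and> (y2, y1) \<in> pverts G2 \<times> pverts G1 \<and>
                   (x2 = y2 \<and> (x1, y1) \<in> parcs G1 \<or>
                    x1 = u1 \<and> y1 = u1 \<and> (x2, y2) \<in> parcs G2)} \<rparr>,
      (u2, u1)))"


lemma (in wf_digraph) awalk_cost_unit: "awalk_cost (\<lambda>_. 1) p = real (length p)"
  by (induction p) auto

lemma gdist_eq_Least: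
  assumes G: "pair_graph G" and c: "Digraph_Component.connected (with_proj G)"
    and uv: "u \<in> pverts G" "v \<in> pverts G"
  shows "gdist G u v =
    ereal (real (LEAST n. \<exists>p. pre_digraph.awalk (with_proj G) u p v \<and> length p = n))"
    (is "_ = ereal (real (Least ?P))")
proof -
  interpret pair_graph G by fact
  have "u \<rightarrow>\<^sup>*\<^bsub>with_proj G\<^esub> v"
    using symmetric_connected_imp_strongly_connected[OF _ c] uv sym_arcs by auto
  then have "\<exists>n. ?P n" by (auto simp: reachable_awalk)
  then have L: "?P (Least ?P)" by (rule LeastI_ex)
  then obtain p where p: "awalk u p v" "length p = Least ?P" by blast
  show ?thesis
  proof (rule antisym)
    show "gdist G u v \<le> ereal (real (Least ?P))"
      using min_cost_le_walk_cost[OF p(1), of "\<lambda>_. 1"] p(2)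
      by (simp add: gdist_def awalk_cost_unit)
    show "ereal (real (Least ?P)) \<le> gdist G u v"
      unfolding gdist_def \<mu>_def
      by (rule INF_greatest) (auto simp: awalk_cost_unit intro!: Least_le)
  qed
qed

lemma pair_graph_hierarchical_product:
  assumes "pair_graph G2" "pair_graph G1"
  shows "pair_graph (fst (hierarchical_product (G2, u2) (G1, u1)))" (is "pair_graph ?H")
proof -
  interpret G2: pair_graph G2 by fact
  interpret G1: pair_graph G1 by fact
  have sub: "parcs ?H \<subseteq> pverts ?H \<times> pverts ?H"
    by (auto simp: hierarchical_product_def)
  have fin: "finite (pverts ?H)"
    by (simp add: hierarchical_product_def G1.pair_finite_verts G2.pair_finite_verts)
  have s1: "(y, x) \<in> parcs G1" if "(x, y) \<in> parcs G1" for x y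
    using that G1.arcs_symmetric by blast
  have s2: "(y, x) \<in> parcs G2" if "(x, y) \<in> parcs G2" for x y
    using that G2.arcs_symmetric by blast
  have "symmetric (with_proj ?H)"
    by (auto simp: symmetric_def sym_def hierarchical_product_def intro: s1 s2)
  moreover have "fst e \<noteq> snd e" if "e \<in> parcs ?H" for e
    using that by (auto simp: hierarchical_product_def dest: G1.no_loops' G2.no_loops')
  moreover have "finite (parcs ?H)"
    using sub fin by (meson finite_SigmaI finite_subset)
  ultimately show ?thesis
    using sub fin by unfold_locales auto
qed

lemma least_weight:
  fixes V :: "'a set" and F :: "'a set set"
  assumes V: "finite V" and F: "\<And>A. A \<in> F \<Longrightarrow> A \<subseteq> V \<and> A \<noteq> {}"
  defines "P \<equiv> \<lambda>g::'a \<Rightarrow> real. g \<in> V \<rightarrow> {0..1} \<and> (\<forall>A\<in>F. sum g A \<ge> 1)"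
  shows "\<exists>g. P g \<and> (\<forall>h. P h \<longrightarrow> sum g V \<le> sum h V)"
proof -
  define T where "T = product_topology (\<lambda>_::'a. euclideanreal) V"
  define C where "C = (\<lambda>A. {g \<in> topspace T. sum g A \<in> {1::real..}})"
  define K where "K = (V \<rightarrow>\<^sub>E {0..1::real}) \<inter> (topspace T \<inter> \<Inter> (C ` F))"
  have cont: "continuous_map T euclideanreal (\<lambda>g. sum g A)" if "A \<subseteq> V" for A
    using that finite_subset[OF that V] unfolding T_def
    by (intro continuous_map_sum continuous_map_product_projection) auto
  have "closedin T (C A)" if "A \<in> F" for A
    unfolding C_def using F[OF that] cont
    by (intro closedin_continuous_map_preimage[where Y = euclideanreal]) auto
  then have "closedin T (topspace T \<inter> \<Inter> (C ` F))"
    by (cases "F = {}") (auto intro!: closedin_Int closedin_Inter)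
  moreover have "compactin T (V \<rightarrow>\<^sub>E {0..1::real})"
    unfolding T_def compactin_PiE by simp
  ultimately have "compactin T K"
    unfolding K_def by (metis compact_Int_closedin)
  then have "compact ((\<lambda>g. sum g V) ` K)"
    using image_compactin[OF _ cont[of V]] by simp
  moreover have K: "restrict g V \<in> K" if "P g" for g
  proof -
    have "sum (restrict g V) A = sum g A" if "A \<in> F" for A
      using F[OF that] by (intro sum.cong) auto
    then show ?thesis
      using that unfolding K_def C_def T_def P_def by (auto simp: Pi_iff)
  qed
  moreover have "P (\<lambda>_. 1)"
  proof -
    have "card A \<ge> 1" if "A \<in> F" for A
      using F[OF that] finite_subset[OF _ V] by (simp add: Suc_le_eq card_gt_0_iff)
    then show ?thesis by (auto simp: P_def)
  qed
  ultimately obtain g where g: "g \<in> K" "\<forall>h\<in>K. sum g V \<le> sum h V"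
    using compact_attains_inf[of "(\<lambda>g. sum g V) ` K"] by blast
  have "P g"
    using g(1) by (auto simp: K_def C_def P_def PiE_def)
  moreover have "sum g V \<le> sum h V" if "P h" for h
    using g(2) K[OF that] by force
  ultimately show ?thesis by blast
qed

lemma resolving_set_nonempty:
  assumes "pair_graph G" "u \<in> pverts G" "v \<in> pverts G" "u \<noteq> v"
  shows "u \<in> resolving_set G u v"
proof -
  interpret pair_graph G by fact
  have "gdist G u u \<le> 0"
    using min_cost_le_walk_cost[of u "[]" u "\<lambda>_. 1"] assms
    by (simp add: gdist_def awalk_Nil_iff zero_ereal_def)
  moreover have "1 \<le> real (length p)" if "awalk v p u" for p
    using that assms by (cases p) (auto simp: awalk_Nil_iff)
  then have "gdist G v u \<ge> 1"
    unfolding gdist_def \<mu>_def by (intro INF_greatest) (auto simp: awalk_cost_unit)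
  ultimately have "gdist G u u \<noteq> gdist G v u"
    by (metis ereal_less_eq(3) not_one_le_zero one_ereal_def order_trans zero_ereal_def)
  then show ?thesis using assms by (simp add: resolving_set_def)
qed

lemma resolving_function_attains_min:
  assumes G: "pair_graph G"
  shows "\<exists>g. resolving_function G g \<and>
    (\<forall>h. resolving_function G h \<longrightarrow> sum g (pverts G) \<le> sum h (pverts G))"
proof -
  interpret pair_graph G by fact
  define F where "F = {resolving_set G u v | u v. u \<in> pverts G \<and> v \<in> pverts G \<and> u \<noteq> v}"
  have "\<And>A. A \<in> F \<Longrightarrow> A \<subseteq> pverts G \<and> A \<noteq> {}"
    using resolving_set_nonempty[OF G] by (fastforce simp: F_def resolving_set_def)
  from least_weight[OF pair_finite_verts, of F, OF this]
  have "\<exists>g::'a \<Rightarrow> real. (g \<in> pverts G \<rightarrow> {0..1} \<and> (\<forall>A\<in>F. sum g A \<ge> 1)) \<and>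
    (\<forall>h::'a \<Rightarrow> real. h \<in> pverts G \<rightarrow> {0..1} \<and> (\<forall>A\<in>F. sum h A \<ge> 1) \<longrightarrow> sum g (pverts G) \<le> sum h (pverts G))"
    by simp
  moreover have "resolving_function G g \<longleftrightarrow> g \<in> pverts G \<rightarrow> {0..1} \<and> (\<forall>A\<in>F. sum g A \<ge> 1)" for g :: "'a \<Rightarrow> real"
    by (auto simp: resolving_function_def F_def)
  ultimately show ?thesis by presburger
qed

lemma rooted_resolving_function_attains_min:
  assumes G: "pair_graph G"
  shows "\<exists>g. rooted_resolving_function (G, r) g \<and>
    (\<forall>h. rooted_resolving_function (G, r) h \<longrightarrow> sum g (pverts G) \<le> sum h (pverts G))"
proof -
  interpret pair_graph G by fact
  define F where "F = {resolving_set G u v | u v. u \<in> pverts G \<and> v \<in> pverts G \<and> u \<noteq> v \<and>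
    gdist G u r = gdist G v r}"
  have "\<And>A. A \<in> F \<Longrightarrow> A \<subseteq> pverts G \<and> A \<noteq> {}"
    using resolving_set_nonempty[OF G] by (fastforce simp: F_def resolving_set_def)
  from least_weight[OF pair_finite_verts, of F, OF this]
  have "\<exists>g::'a \<Rightarrow> real. (g \<in> pverts G \<rightarrow> {0..1} \<and> (\<forall>A\<in>F. sum g A \<ge> 1)) \<and>
    (\<forall>h::'a \<Rightarrow> real. h \<in> pverts G \<rightarrow> {0..1} \<and> (\<forall>A\<in>F. sum h A \<ge> 1) \<longrightarrow> sum g (pverts G) \<le> sum h (pverts G))"
    by simp
  moreover have "rooted_resolving_function (G, r) g \<longleftrightarrow>
    g \<in> pverts G \<rightarrow> {0..1} \<and> (\<forall>A\<in>F. sum g A \<ge> 1)" for g :: "'a \<Rightarrow> real"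
    by (auto simp: rooted_resolving_function_def F_def)
  ultimately show ?thesis by presburger
qed

end

theory Submission
  imports Defs
begin

text \<open>Every copy of \<open>G\<^sub>1\<close> hangs on the rest of the hierarchical product at its root alone, so two
  vertices at the same distance from the root of their copy are told apart only within that copy.
  A resolving function of the product therefore restricts to a rooted resolving function on each of
  the \<open>|V(G\<^sub>2)|\<close> copies, which gives \<open>\<ge>\<close>.

  For \<open>\<le>\<close>, an optimal rooted resolving function \<open>f\<close> of \<open>G\<^sub>1\<close> is repeated on every copy. Pairs at
  the same distance from the root of a common copy are resolved by the choice of \<open>f\<close>. For every
  other pair, some copy consists entirely of vertices that tell the two apart: if both lie in one
  copy at different distances from its root, any other copy (there is one since \<open>G\<^sub>2\<close> is
  nontrivial); if they lie in different copies, the copy of the vertex nearer to its own root.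
  So it suffices that \<open>f\<close> has weight at least \<open>1\<close>, which holds as soon as some two
  vertices of \<open>G\<^sub>1\<close> are equally far from the root. If there are none, the distance to the root
  numbers the vertices as a path starting at the root, which is the excluded case.

  The distances in the product are found from a local description: the distance to \<open>s\<close> is the only
  function that vanishes at \<open>s\<close>, drops by at most one along an arc, and at every other vertex does
  drop by one along some arc.\<close>

section \<open>Distances as natural numbers\<close>

definition hops :: "'a pair_pre_digraph \<Rightarrow> 'a \<Rightarrow> 'a \<Rightarrow> nat" where
  "hops G u v = (LEAST n. \<exists>p. pre_digraph.awalk (with_proj G) u p v \<and> length p = n)"

lemma gdist_hops:
  assumes "nontrivial_connected_graph G" "u \<in> pverts G" "v \<in> pverts G"
  shows "gdist G u v = ereal (real (hops G u v))"
  using assms unfolding hops_def nontrivial_connected_graph_def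
  by (intro gdist_eq_Least) auto

lemma hops_walk:
  assumes "nontrivial_connected_graph G" "u \<in> pverts G" "v \<in> pverts G"
  obtains p where "pre_digraph.awalk (with_proj G) u p v" "length p = hops G u v"
proof -
  interpret pair_graph G using assms(1) by (simp add: nontrivial_connected_graph_def)
  have "u \<rightarrow>\<^sup>*\<^bsub>with_proj G\<^esub> v"
    using symmetric_connected_imp_strongly_connected[OF sym_arcs] assms
    by (auto simp: nontrivial_connected_graph_def)
  then have "\<exists>n p. awalk u p v \<and> length p = n" by (auto simp: reachable_awalk)
  from LeastI_ex[OF this] show thesis
    using that unfolding hops_def by blast
qed

lemma hops_le:
  assumes "pre_digraph.awalk (with_proj G) u p v"
  shows "hops G u v \<le> length p"
  unfolding hops_def using assms by (intro Least_le) blast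

lemma hops_triangle:
  assumes G: "nontrivial_connected_graph G" and "u \<in> pverts G" "v \<in> pverts G" "w \<in> pverts G"
  shows "hops G u w \<le> hops G u v + hops G v w"
proof -
  interpret pair_graph G using G by (simp add: nontrivial_connected_graph_def)
  obtain p where p: "awalk u p v" "length p = hops G u v" using hops_walk assms by metis
  obtain q where q: "awalk v q w" "length q = hops G v w" using hops_walk assms by metis
  from awalk_appendI[OF p(1) q(1)] have "hops G u w \<le> length (p @ q)" by (rule hops_le)
  with p q show ?thesis by simp
qed

definition distance_to :: "'a pair_pre_digraph \<Rightarrow> 'a \<Rightarrow> ('a \<Rightarrow> nat) \<Rightarrow> bool" where
  "distance_to G s f \<longleftrightarrow> f s = 0 \<and> (\<forall>(v, w) \<in> parcs G. f v \<le> Suc (f w)) \<and>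
     (\<forall>v \<in> pverts G. v \<noteq> s \<longrightarrow> (\<exists>w. (v, w) \<in> parcs G \<and> f v = Suc (f w)))"

text \<open>The bound on the drop makes every walk to \<open>s\<close> at least as long as \<open>f\<close> prescribes, and
  following the arcs along which \<open>f\<close> drops gives a walk of exactly that length.\<close>

lemma gdist_distance_to:
  assumes "pair_graph G" and f: "distance_to G s f" and s: "s \<in> pverts G" and v: "v \<in> pverts G"
  shows "gdist G v s = ereal (real (f v))"
proof (rule antisym)
  interpret pair_graph G by fact
  have "\<exists>p. awalk v p s \<and> length p = f v"
    using v
  proof (induction "f v" arbitrary: v)
    case 0
    then have "v = s" using f by (force simp: distance_to_def)
    then show ?case using s 0 by (auto simp: awalk_Nil_iff)
  next
    case (Suc n)
    then have "v \<noteq> s" using f by (auto simp: distance_to_def)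
    then obtain w where w: "(v, w) \<in> parcs G" "f v = Suc (f w)"
      using f Suc.prems by (auto simp: distance_to_def)
    then have "w \<in> pverts G" using wellformed by fastforce
    then obtain p where "awalk w p s" "length p = f w" using Suc w by auto
    then have "awalk v ((v, w) # p) s \<and> length ((v, w) # p) = f v"
      using w by (simp add: awalk_Cons_iff)
    then show ?case by blast
  qed
  then obtain p where p: "awalk v p s" "length p = f v" by blast
  show "gdist G v s \<le> ereal (real (f v))"
    using min_cost_le_walk_cost[OF p(1), of "\<lambda>_. 1"] p(2)
    by (simp add: gdist_def awalk_cost_unit)
  have "f v \<le> length p" if "awalk v p s" for p
    using that
  proof (induction p arbitrary: v)
    case Nil
    then show ?case using f by (auto simp: awalk_Nil_iff distance_to_def)
  next
    case (Cons e p)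
    then have "e \<in> parcs G" "v = fst e" "awalk (snd e) p s" by (auto simp: awalk_Cons_iff)
    with Cons.IH[of "snd e"] show ?case
      using f by (cases e) (fastforce simp: distance_to_def)
  qed
  then show "ereal (real (f v)) \<le> gdist G v s"
    unfolding gdist_def \<mu>_def by (intro INF_greatest) (auto simp: awalk_cost_unit)
qed

lemma distance_to_hops:
  assumes G: "nontrivial_connected_graph G" and s: "s \<in> pverts G"
  shows "distance_to G s (\<lambda>v. hops G v s)"
  unfolding distance_to_def
proof (intro conjI ballI impI; clarify?)
  interpret pair_graph G using G by (simp add: nontrivial_connected_graph_def)
  have "awalk s [] s" using s by (simp add: awalk_Nil_iff)
  from hops_le[OF this] show "hops G s s = 0" by simp
  have step: "hops G v s \<le> Suc (hops G w s)" if "(v, w) \<in> parcs G" for v w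
  proof -
    have "w \<in> pverts G" using that wellformed by fastforce
    with hops_walk[OF G _ s] obtain p where "awalk w p s" "length p = hops G w s" by metis
    with that hops_le[of G v "(v, w) # p" s] show ?thesis by (simp add: awalk_Cons_iff)
  qed
  then show "hops G v s \<le> Suc (hops G w s)" if "(v, w) \<in> parcs G" for v w using that .
  fix v assume v: "v \<in> pverts G" "v \<noteq> s"
  obtain p where p: "awalk v p s" "length p = hops G v s" using hops_walk[OF G v(1) s] .
  with v obtain e q where "p = e # q" by (cases p) (auto simp: awalk_Nil_iff)
  with p have e: "e \<in> parcs G" "v = fst e" "awalk (snd e) q s" "hops G v s = Suc (length q)"
    by (auto simp: awalk_Cons_iff)
  with hops_le[OF e(3)] step[of v "snd e"] have "hops G v s = Suc (hops G (snd e) s)" by simp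
  with e(1,2) show "\<exists>w. (v, w) \<in> parcs G \<and> hops G v s = Suc (hops G w s)"
    by (metis prod.collapse)
qed

section \<open>Paths rooted at an end-vertex\<close>

text \<open>Under an injective distance function, each vertex but the root has a neighbour one step
  closer, so the distances attained are \<open>0, \<dots>, n - 1\<close>; the unique vertex at distance \<open>i\<close> is the
  \<open>i\<close>-th of the path, and two vertices are adjacent exactly if their distances differ by one.\<close>

lemma path_with_end_root_if_inj_hops:
  assumes G: "nontrivial_connected_graph G" and u: "u \<in> pverts G"
    and inj: "inj_on (\<lambda>v. hops G v u) (pverts G)"
  shows "path_with_end_root (G, u)"
proof -
  interpret pair_graph G using G by (simp add: nontrivial_connected_graph_def)
  define d where "d = (\<lambda>v. hops G v u)"
  define n where "n = card (pverts G)"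
  have inj_d: "inj_on d (pverts G)" using inj by (simp add: d_def)
  have d: "distance_to G u d" using distance_to_hops[OF G u] by (simp add: d_def)
  then have d0: "d u = 0"
    and le: "\<And>v w. (v, w) \<in> parcs G \<Longrightarrow> d v \<le> Suc (d w)"
    and closer: "\<And>v. v \<in> pverts G \<Longrightarrow> v \<noteq> u \<Longrightarrow> \<exists>w. (v, w) \<in> parcs G \<and> d v = Suc (d w)"
    by (auto simp: distance_to_def)
  have verts: "v \<in> pverts G" "w \<in> pverts G" if "(v, w) \<in> parcs G" for v w
    using that wellformed by fastforce+
  have sym: "(w, v) \<in> parcs G" if "(v, w) \<in> parcs G" for v w
    using that arcs_symmetric by blast
  have below: "{..d v} \<subseteq> d ` pverts G" if "v \<in> pverts G" for v
    using that
  proof (induction "d v" arbitrary: v)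
    case 0
    then show ?case by (metis atMost_0 empty_subsetI image_eqI insert_subset)
  next
    case (Suc k)
    then obtain w where "(v, w) \<in> parcs G" "d v = Suc (d w)"
      using closer d0 by (metis nat.distinct(1))
    with Suc verts[of v w] have "{..d w} \<subseteq> d ` pverts G" "{..d v} = insert (d v) {..d w}"
      by (auto simp: atMost_Suc)
    with Suc.prems show ?case by simp
  qed
  have fin: "finite (d ` pverts G)" by simp
  have card: "card (d ` pverts G) = n" using card_image[OF inj_d] by (simp add: n_def)
  have "d v < n" if "v \<in> pverts G" for v
    using card_mono[OF fin below[OF that]] card by simp
  then have "d ` pverts G \<subseteq> {..<n}" by auto
  then have im: "d ` pverts G = {..<n}" using card by (intro card_subset_eq) auto
  define x where "x = inv_into (pverts G) d"
  have x: "x i \<in> pverts G" "d (x i) = i" if "i < n" for i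
    using that im unfolding x_def by (auto intro!: inv_into_into f_inv_into_f)
  have xd: "x (d v) = v" if "v \<in> pverts G" for v
    using that inj_d by (simp add: x_def)
  have dn: "d v < n" if "v \<in> pverts G" for v using that im by blast
  have arc_if_successive: "(w, v) \<in> parcs G" if "v \<in> pverts G" "w \<in> pverts G" "d w = Suc (d v)" for v w
  proof -
    from that d0 have "w \<noteq> u" by auto
    with closer that obtain v' where v': "(w, v') \<in> parcs G" "d w = Suc (d v')" by blast
    with that verts inj_d have "v' = v" by (auto simp: inj_on_def)
    with v' show ?thesis by simp
  qed
  define xs where "xs = map x [0..<n]"
  have len: "length xs = n" and nth: "\<And>i. i < n \<Longrightarrow> xs ! i = x i" by (auto simp: xs_def)
  have n0: "n > 0" using u by (auto simp: n_def card_gt_0_iff)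
  have "parcs G = {(xs ! i, xs ! Suc i) | i. Suc i < length xs} \<union>
                 {(xs ! Suc i, xs ! i) | i. Suc i < length xs}" (is "_ = ?A \<union> ?B")
  proof (intro equalityI subsetI)
    fix e assume e: "e \<in> parcs G"
    obtain v w where vw: "e = (v, w)" by (cases e)
    with e have vw': "(v, w) \<in> parcs G" "(w, v) \<in> parcs G" using sym by auto
    note V = verts[OF vw'(1)]
    have "v \<noteq> w" using vw'(1) no_loops' by auto
    then have "d v \<noteq> d w" using inj_d V by (auto simp: inj_on_def)
    then have "d w = Suc (d v) \<or> d v = Suc (d w)" using le[OF vw'(1)] le[OF vw'(2)] by linarith
    then show "e \<in> ?A \<union> ?B"
    proof
      assume a: "d w = Suc (d v)"
      have "e = (xs ! d v, xs ! Suc (d v))"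
        using V dn a xd[OF V(1)] xd[OF V(2)] by (simp add: vw nth flip: a)
      moreover have "Suc (d v) < length xs" using dn[OF V(2)] a len by simp
      ultimately show ?thesis by blast
    next
      assume a: "d v = Suc (d w)"
      have "e = (xs ! Suc (d w), xs ! d w)"
        using V dn a xd[OF V(1)] xd[OF V(2)] by (simp add: vw nth flip: a)
      moreover have "Suc (d w) < length xs" using dn[OF V(1)] a len by simp
      ultimately show ?thesis by blast
    qed
  next
    fix e assume "e \<in> ?A \<union> ?B"
    then obtain i where i: "Suc i < n" "e = (x i, x (Suc i)) \<or> e = (x (Suc i), x i)"
      using len nth by auto
    have "(x (Suc i), x i) \<in> parcs G"
      using i x[of i] x[of "Suc i"] by (intro arc_if_successive) auto
    with i sym show "e \<in> parcs G" by blast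
  qed
  moreover have "distinct xs"
    unfolding xs_def distinct_map using x(2) by (auto intro!: inj_onI) (metis x(2))
  moreover have "pverts G = set xs"
    using x(1) xd dn by (force simp: xs_def)
  moreover have "u = hd xs"
    using n0 xd[OF u] d0 by (simp add: xs_def hd_map upt_rec)
  moreover have "xs \<noteq> []" using n0 by (simp add: xs_def)
  ultimately show ?thesis unfolding path_with_end_root_def by blast
qed

section \<open>Rooted resolving functions\<close>

lemma rooted_resolving_function_weight_ge_1:
  assumes G: "nontrivial_connected_graph G" and u: "u \<in> pverts G"
    and np: "\<not> path_with_end_root (G, u)" and f: "rooted_resolving_function (G, u) f"
  shows "sum f (pverts G) \<ge> 1"
proof -
  interpret pair_graph G using G by (simp add: nontrivial_connected_graph_def)
  obtain v w where vw: "v \<in> pverts G" "w \<in> pverts G" "v \<noteq> w" "hops G v u = hops G w u"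
    using path_with_end_root_if_inj_hops[OF G u] np by (auto simp: inj_on_def)
  then have "1 \<le> sum f (resolving_set G v w)"
    using f gdist_hops[OF G _ u] by (auto simp: rooted_resolving_function_def)
  also have "\<dots> \<le> sum f (pverts G)"
    using f by (intro sum_mono2) (auto simp: resolving_set_def rooted_resolving_function_def Pi_iff)
  finally show ?thesis .
qed

section \<open>The hierarchical product\<close>

lemma pverts_hierarchical_product:
  "pverts (fst (hierarchical_product (G2, u2) (G1, u1))) = pverts G2 \<times> pverts G1"
  by (simp add: hierarchical_product_def)

text \<open>A shortest path between different copies of \<open>G1\<close> leaves the first one and enters the second
  one through their roots.\<close>

lemma gdist_hierarchical_product:
  assumes G1: "nontrivial_connected_graph G1" and u1: "u1 \<in> pverts G1"
    and G2: "nontrivial_connected_graph G2"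
    and x: "x2 \<in> pverts G2" "x1 \<in> pverts G1" and t: "t2 \<in> pverts G2" "t1 \<in> pverts G1"
  shows "gdist (fst (hierarchical_product (G2, u2) (G1, u1))) (x2, x1) (t2, t1) =
    ereal (real (if x2 = t2 then hops G1 x1 t1
                 else hops G1 x1 u1 + hops G2 x2 t2 + hops G1 u1 t1))"
proof -
  let ?H = "fst (hierarchical_product (G2, u2) (G1, u1))"
  define f where "f = (\<lambda>(x2, x1). if x2 = t2 then hops G1 x1 t1
                 else hops G1 x1 u1 + hops G2 x2 t2 + hops G1 u1 t1)"
  interpret G1: pair_graph G1 using G1 by (simp add: nontrivial_connected_graph_def)
  interpret G2: pair_graph G2 using G2 by (simp add: nontrivial_connected_graph_def)
  note d1t = distance_to_hops[OF G1 t(2), unfolded distance_to_def]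
  note d1u = distance_to_hops[OF G1 u1, unfolded distance_to_def]
  note d2t = distance_to_hops[OF G2 t(1), unfolded distance_to_def]
  have arcs: "((a2, a1), (b2, b1)) \<in> parcs ?H \<longleftrightarrow>
      a2 = b2 \<and> a2 \<in> pverts G2 \<and> (a1, b1) \<in> parcs G1 \<or>
      a1 = u1 \<and> b1 = u1 \<and> (a2, b2) \<in> parcs G2" for a2 a1 b2 b1
    using u1 G1.wellformed G2.wellformed by (fastforce simp: hierarchical_product_def)
  have "distance_to ?H (t2, t1) f"
    unfolding distance_to_def
  proof (intro conjI ballI impI)
    show "f (t2, t1) = 0" using d1t by (simp add: f_def)
  next
    fix e assume e: "e \<in> parcs ?H"
    obtain a2 a1 b2 b1 where eq: "e = ((a2, a1), (b2, b1))" by (metis surj_pair)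
    from e[unfolded eq arcs] have "f (a2, a1) \<le> Suc (f (b2, b1))"
    proof
      assume "a2 = b2 \<and> a2 \<in> pverts G2 \<and> (a1, b1) \<in> parcs G1"
      with d1t d1u show ?thesis by (auto simp: f_def)
    next
      assume a: "a1 = u1 \<and> b1 = u1 \<and> (a2, b2) \<in> parcs G2"
      then have "hops G2 a2 t2 \<le> Suc (hops G2 b2 t2)" using d2t by blast
      with a d1u d2t show ?thesis by (auto simp: f_def)
    qed
    then show "case e of (v, w) \<Rightarrow> f v \<le> Suc (f w)" by (simp add: eq)
  next
    fix v assume v: "v \<in> pverts ?H" "v \<noteq> (t2, t1)"
    obtain a2 a1 where eq: "v = (a2, a1)" by (cases v)
    with v have a: "a2 \<in> pverts G2" "a1 \<in> pverts G1" by (auto simp: pverts_hierarchical_product)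
    consider "a2 = t2" "a1 \<noteq> t1" | "a2 \<noteq> t2" "a1 \<noteq> u1" | "a2 \<noteq> t2" "a1 = u1"
      using v eq by blast
    then have "\<exists>b2 b1. ((a2, a1), (b2, b1)) \<in> parcs ?H \<and> f (a2, a1) = Suc (f (b2, b1))"
    proof cases
      case 1
      with d1t a obtain b where "(a1, b) \<in> parcs G1" "hops G1 a1 t1 = Suc (hops G1 b t1)" by blast
      with 1 a show ?thesis unfolding arcs f_def by (intro exI[of _ a2] exI[of _ b]) auto
    next
      case 2
      with d1u a obtain b where "(a1, b) \<in> parcs G1" "hops G1 a1 u1 = Suc (hops G1 b u1)" by blast
      with 2 a show ?thesis unfolding arcs f_def by (intro exI[of _ a2] exI[of _ b]) auto
    next
      case 3
      with d2t a obtain b where "(a2, b) \<in> parcs G2" "hops G2 a2 t2 = Suc (hops G2 b t2)" by blast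
      with 3 d1u d2t show ?thesis unfolding arcs f_def by (intro exI[of _ b] exI[of _ u1]) auto
    qed
    then show "\<exists>w. (v, w) \<in> parcs ?H \<and> f v = Suc (f w)" using eq by blast
  qed
  from gdist_distance_to[OF pair_graph_hierarchical_product[OF G2.pair_graph_axioms G1.pair_graph_axioms] this]
  show ?thesis using x t by (simp add: pverts_hierarchical_product f_def)
qed

text \<open>From outside the copy of \<open>G1\<close> over \<open>x\<close>, only the distance to its root is visible.\<close>

lemma resolving_set_same_copy:
  assumes G1: "nontrivial_connected_graph G1" and u1: "u1 \<in> pverts G1"
    and G2: "nontrivial_connected_graph G2"
    and x: "x \<in> pverts G2" and v: "v \<in> pverts G1" and w: "w \<in> pverts G1"
    and eq: "hops G1 v u1 = hops G1 w u1"
  shows "resolving_set (fst (hierarchical_product (G2, u2) (G1, u1))) (x, v) (x, w) =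
    {x} \<times> resolving_set G1 v w"
  using x v w eq
  by (auto simp: resolving_set_def pverts_hierarchical_product gdist_hops[OF G1]
      gdist_hierarchical_product[OF G1 u1 G2] split: if_splits)

text \<open>Every copy but the one over \<open>x\<close> is reached through the root of the latter, so different
  distances to that root stay different.\<close>

lemma other_copy_resolves:
  assumes G1: "nontrivial_connected_graph G1" and u1: "u1 \<in> pverts G1"
    and G2: "nontrivial_connected_graph G2"
    and x: "x \<in> pverts G2" and y: "y \<in> pverts G2" "y \<noteq> x"
    and v: "v \<in> pverts G1" and w: "w \<in> pverts G1"
    and neq: "hops G1 v u1 \<noteq> hops G1 w u1"
  shows "{y} \<times> pverts G1 \<subseteq>
    resolving_set (fst (hierarchical_product (G2, u2) (G1, u1))) (x, v) (x, w)"
  using x y v w neq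
  by (auto simp: resolving_set_def pverts_hierarchical_product
      gdist_hierarchical_product[OF G1 u1 G2])

text \<open>To reach a vertex in the copy over \<open>x\<close>, \<open>(x, v)\<close> may go through the root of that copy,
  while \<open>(y, w)\<close> has to, after first going to its own root, which is no nearer to it, and then
  from copy to copy.\<close>

lemma nearer_copy_resolves:
  assumes G1: "nontrivial_connected_graph G1" and u1: "u1 \<in> pverts G1"
    and G2: "nontrivial_connected_graph G2"
    and x: "x \<in> pverts G2" and y: "y \<in> pverts G2" "y \<noteq> x"
    and v: "v \<in> pverts G1" and w: "w \<in> pverts G1"
    and le: "hops G1 v u1 \<le> hops G1 w u1"
  shows "{x} \<times> pverts G1 \<subseteq>
    resolving_set (fst (hierarchical_product (G2, u2) (G1, u1))) (x, v) (y, w)"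
proof -
  have "hops G1 v z < hops G1 w u1 + hops G2 y x + hops G1 u1 z" if z: "z \<in> pverts G1" for z
  proof -
    have "hops G2 y x > 0"
      using distance_to_hops[OF G2 x] y by (auto simp: distance_to_def)
    with hops_triangle[OF G1 v u1 z] le show ?thesis by linarith
  qed
  then show ?thesis
    using x y v w
    by (force simp: resolving_set_def pverts_hierarchical_product
        gdist_hierarchical_product[OF G1 u1 G2])
qed

lemma resolving_set_commute: "resolving_set G u v = resolving_set G v u"
  by (auto simp: resolving_set_def)

lemma resolving_function_restricts_to_copy:
  assumes G1: "nontrivial_connected_graph G1" and u1: "u1 \<in> pverts G1"
    and G2: "nontrivial_connected_graph G2" and x: "x \<in> pverts G2"
    and h: "resolving_function (fst (hierarchical_product (G2, u2) (G1, u1))) h"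
  shows "rooted_resolving_function (G1, u1) (\<lambda>v. h (x, v))"
proof -
  have "1 \<le> (\<Sum>z\<in>resolving_set G1 v w. h (x, z))"
    if "v \<in> pverts G1" "w \<in> pverts G1" "v \<noteq> w" "gdist G1 v u1 = gdist G1 w u1" for v w
  proof -
    have "hops G1 v u1 = hops G1 w u1" using that gdist_hops[OF G1 _ u1] by simp
    from resolving_set_same_copy[OF G1 u1 G2 x that(1,2) this]
    have "1 \<le> sum h ({x} \<times> resolving_set G1 v w)"
      using h x that unfolding resolving_function_def pverts_hierarchical_product
      by (metis SigmaI prod.inject)
    also have "\<dots> = (\<Sum>z\<in>resolving_set G1 v w. h (x, z))"
      using sum.cartesian_product[of "\<lambda>a b. h (a, b)" "resolving_set G1 v w" "{x}"] by simp
    finally show ?thesis .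
  qed
  moreover have "(\<lambda>v. h (x, v)) \<in> pverts G1 \<rightarrow> {0..1}"
    using h x by (auto simp: resolving_function_def pverts_hierarchical_product)
  ultimately show ?thesis by (simp add: rooted_resolving_function_def)
qed

lemma resolving_function_repeated_on_copies:
  assumes G1: "nontrivial_connected_graph G1" and u1: "u1 \<in> pverts G1"
    and G2: "nontrivial_connected_graph G2"
    and np: "\<not> path_with_end_root (G1, u1)"
    and f: "rooted_resolving_function (G1, u1) f"
  shows "resolving_function (fst (hierarchical_product (G2, u2) (G1, u1))) (\<lambda>(x, v). f v)"
    (is "resolving_function ?H ?g")
proof -
  interpret G1: pair_graph G1 using G1 by (simp add: nontrivial_connected_graph_def)
  interpret G2: pair_graph G2 using G2 by (simp add: nontrivial_connected_graph_def)
  have f01: "f \<in> pverts G1 \<rightarrow> {0..1}" using f by (simp add: rooted_resolving_function_def)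
  have on_copy: "sum ?g ({x} \<times> A) = sum f A" for x and A :: "'a set"
    using sum.cartesian_product[of "\<lambda>a b. f b" A "{x}"] by simp
  have whole_copy: "1 \<le> sum ?g (resolving_set ?H p q)"
    if "{x} \<times> pverts G1 \<subseteq> resolving_set ?H p q" for x p q
  proof -
    have "1 \<le> sum ?g ({x} \<times> pverts G1)"
      using rooted_resolving_function_weight_ge_1[OF G1 u1 np f] on_copy by simp
    also have "\<dots> \<le> sum ?g (resolving_set ?H p q)"
      using that f01 G1.pair_finite_verts G2.pair_finite_verts
      by (intro sum_mono2)
        (auto simp: resolving_set_def pverts_hierarchical_product Pi_iff)
    finally show ?thesis .
  qed
  have "1 \<le> sum ?g (resolving_set ?H (x, v) (y, w))"
    if V: "x \<in> pverts G2" "v \<in> pverts G1" "y \<in> pverts G2" "w \<in> pverts G1"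
      and neq: "(x, v) \<noteq> (y, w)" for x v y w
  proof -
    consider "x = y" "hops G1 v u1 = hops G1 w u1" | "x = y" "hops G1 v u1 \<noteq> hops G1 w u1"
      | "x \<noteq> y" "hops G1 v u1 \<le> hops G1 w u1" | "x \<noteq> y" "hops G1 w u1 \<le> hops G1 v u1"
      by linarith
    then show ?thesis
    proof cases
      case 1
      then have "1 \<le> sum f (resolving_set G1 v w)"
        using f V neq gdist_hops[OF G1 _ u1] by (auto simp: rooted_resolving_function_def)
      with 1 show ?thesis
        using resolving_set_same_copy[OF G1 u1 G2 V(1,2,4)] on_copy by simp
    next
      case 2
      have "\<not> pverts G2 \<subseteq> {x}"
        using G2 card_mono[of "{x}" "pverts G2"] by (auto simp: nontrivial_connected_graph_def)
      then obtain z where "z \<in> pverts G2" "z \<noteq> x" by blast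
      with 2 show ?thesis
        using whole_copy[OF other_copy_resolves[OF G1 u1 G2 V(1) _ _ V(2,4)]] by simp
    next
      case 3
      then show ?thesis
        using whole_copy[OF nearer_copy_resolves[OF G1 u1 G2 V(1,3) _ V(2,4)]] by simp
    next
      case 4
      then show ?thesis
        using whole_copy[OF nearer_copy_resolves[OF G1 u1 G2 V(3,1) _ V(4,2)]]
        by (simp add: resolving_set_commute)
    qed
  qed
  moreover have "?g \<in> pverts ?H \<rightarrow> {0..1}"
    using f01 by (auto simp: pverts_hierarchical_product)
  ultimately show ?thesis
    by (auto simp: resolving_function_def pverts_hierarchical_product)
qed

theorem theorem3p3:
  fixes G1 :: "'a pair_pre_digraph" and G2 :: "'b pair_pre_digraph"
  assumes "nontrivial_connected_graph G1" and "u1 \<in> pverts G1"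
    and "nontrivial_connected_graph G2" and "u2 \<in> pverts G2"
    and "\<not> path_with_end_root (G1, u1)"
  shows "frac_metric_dim (fst (hierarchical_product (G2, u2) (G1, u1))) =
         real (card (pverts G2)) * frac_rooted_metric_dim (G1, u1)"
proof -
  let ?H = "fst (hierarchical_product (G2, u2) (G1, u1))"
  note G = assms(1,2,3)
  have "pair_graph G1" using assms(1) by (simp add: nontrivial_connected_graph_def)
  from rooted_resolving_function_attains_min[OF this, of u1]
  obtain f where f: "rooted_resolving_function (G1, u1) f"
    and min: "\<And>h. rooted_resolving_function (G1, u1) h \<Longrightarrow> sum f (pverts G1) \<le> sum h (pverts G1)"
    by blast
  have rdim: "frac_rooted_metric_dim (G1, u1) = sum f (pverts G1)"
    unfolding frac_rooted_metric_dim_def using f min by (intro Least_equality) auto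
  have weight: "sum g (pverts ?H) = (\<Sum>x\<in>pverts G2. \<Sum>v\<in>pverts G1. g (x, v))"
    for g :: "'b \<times> 'a \<Rightarrow> real"
    by (simp add: pverts_hierarchical_product sum.cartesian_product)
  show ?thesis
    unfolding frac_metric_dim_def rdim
  proof (rule Least_equality)
    show "\<exists>g. resolving_function ?H g \<and>
        real (card (pverts G2)) * sum f (pverts G1) = sum g (pverts ?H)"
      using resolving_function_repeated_on_copies[OF G assms(5) f, of u2] by (intro exI) (auto simp: weight)
  next
    fix r assume "\<exists>g. resolving_function ?H g \<and> r = sum g (pverts ?H)"
    then obtain h where h: "resolving_function ?H h" "r = sum h (pverts ?H)" by blast
    have "sum f (pverts G1) \<le> (\<Sum>v\<in>pverts G1. h (x, v))" if "x \<in> pverts G2" for x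
      using min[OF resolving_function_restricts_to_copy[OF G that h(1)]] .
    from sum_mono[OF this] show "real (card (pverts G2)) * sum f (pverts G1) \<le> r"
      by (simp add: h(2) weight)
  qed
qed

end
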